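(* If $X$ is a Chermak partial group, then $X_1$ equipped with its partial binary multiplication is a binary partial group.
   Context: **Notation.** For expressions $a,b$ which may or may not be defined, $a \asymp b$ means that either both are undefined, or both are defined and $a=b$. **Binary partial groups.** A unital partial magma is a set $P$ with a partially defined binary operation $P\times P \nrightarrow P$, written $(a,b)\mapsto ab$, and an element $1\in P$ such that $a1\asymp a\asymp 1a$ for all $a\in P$. A binary partial group is a unital partial magma $P$ such that for each $a\in P$ there exists $a^\dagger\in P$ satisfying both of the following for all $b\in P$: (1) if $ab$ is defined then $a^\dagger(ab)\asymp b$; (2) if $ba$ is defined then $(ba)a^\dagger\asymp b$. **Chermak partial groups.** Let $\Upsilon$ be the category with objects $[n]=\{0,1,\dots,n\}$, $n\ge 0$, and morphisms all functions. A symmetric set is a functor $X\colon \Upsilon^{\mathrm{op}}\to \mathsf{Set}$; restricting along $\Delta^{\mathrm{op}}\to\Upsilon^{\mathrm{op}}$ gives its underlying simplicial set. The Segal map $\mathscr{E}_n\colon X_n\to X_1^{\times n}$ has $i$-th component ($1\le i\le n$) induced by $[1]\to[n]$, $0\mapsto i-1$, $1\mapsto i$. A symmetric set is spiny if $\mathscr{E}_n$ is injective for all $n\ge 2$, and reduced if $X_0$ is a one-point set. A (Chermak) partial group is a reduced spiny symmetric set. **Partial binary multiplication on $X_1$.** It is given by the span $X_1\times X_1 \xleftarrow{\mathscr{E}_2} X_2\xrightarrow{d_1}X_1$: for $x,y\in X_1$, the product $xy$ is defined if and only if $(x,y)=\mathscr{E}_2(z)$ for some (necessarily unique) $z\in X_2$,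 in which case $xy:=d_1(z)$ (the edge of $z$ from vertex $0$ to vertex $2$). The unit $1\in X_1$ is the degenerate 1-simplex on the unique element of $X_0$. *)

theory Defs
  imports "HOL-Library.FuncSet"
begin

text \<open>
  A partial operation on a carrier set \<open>P\<close> is an \<open>option\<close>-valued function, \<open>None\<close> meaning
  ``undefined''; only its values on \<open>P\<close> matter. The relation \<open>\<asymp>\<close> is then equality of options,
  and an expression that is always defined, such as an element \<open>a\<close>, is read as \<open>Some a\<close>.
\<close>

locale unital_partial_magma =
  fixes P :: "'a set" and mult :: "'a \<Rightarrow> 'a \<Rightarrow> 'a option" and one :: 'a
  assumes mult_closed: "a \<in> P \<Longrightarrow> b \<in> P \<Longrightarrow> mult a b = Some c \<Longrightarrow> c \<in> P"
    and one_closed: "one \<in> P"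
    and mult_one_right: "a \<in> P \<Longrightarrow> mult a one = Some a"
    and mult_one_left: "a \<in> P \<Longrightarrow> mult one a = Some a"

locale binary_partial_group = unital_partial_magma +
  assumes dagger_ex: "a \<in> P \<Longrightarrow>
    \<exists>a'\<in>P. \<forall>b\<in>P. (\<forall>c. mult a b = Some c \<longrightarrow> mult a' c = Some b) \<and>
                  (\<forall>c. mult b a = Some c \<longrightarrow> mult c a' = Some b)"

text \<open>
  The category \<open>\<Upsilon>\<close>: the object \<open>[n]\<close> is \<^term>\<open>{..n}\<close>, and morphisms are all functions,
  represented extensionally so that they are determined by their values on the source.
\<close>

definition Upsilon_hom :: "nat \<Rightarrow> nat \<Rightarrow> (nat \<Rightarrow> nat) set" where
  "Upsilon_hom m n = {..m} \<rightarrow>\<^sub>E {..n}"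

text \<open>
  A functor from the opposite of \<open>\<Upsilon>\<close> to sets: \<open>act m n f\<close> is the map from \<open>X n\<close> to \<open>X m\<close>
  induced by \<open>f\<close> from \<open>[m]\<close> to \<open>[n]\<close>. All \<open>X n\<close> live in one type, which is no restriction,
  and need not be disjoint.
\<close>

locale symmetric_set =
  fixes X :: "nat \<Rightarrow> 'a set" and act :: "nat \<Rightarrow> nat \<Rightarrow> (nat \<Rightarrow> nat) \<Rightarrow> 'a \<Rightarrow> 'a"
  assumes act_closed: "f \<in> Upsilon_hom m n \<Longrightarrow> x \<in> X n \<Longrightarrow> act m n f x \<in> X m"
    and act_id: "x \<in> X n \<Longrightarrow> act n n (\<lambda>i\<in>{..n}. i) x = x"
    and act_compose: "f \<in> Upsilon_hom l m \<Longrightarrow> g \<in> Upsilon_hom m n \<Longrightarrow> x \<in> X n \<Longrightarrow>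
      act l n (compose {..l} g f) x = act l m f (act m n g x)"
begin

definition edge :: "nat \<Rightarrow> nat \<Rightarrow> nat \<Rightarrow> 'a \<Rightarrow> 'a" where
  "edge n i j x = act 1 n (\<lambda>k\<in>{..1}. if k = 0 then i else j) x"

text \<open>An \<open>n\<close>-tuple of elements of \<^term>\<open>X 1\<close> is a list of length \<open>n\<close>.\<close>

definition segal :: "nat \<Rightarrow> 'a \<Rightarrow> 'a list" where
  "segal n x = map (\<lambda>i. edge n (i - 1) i x) [1..<Suc n]"

definition spiny :: bool where
  "spiny \<longleftrightarrow> (\<forall>n\<ge>2. inj_on (segal n) (X n))"

definition reduced :: bool where
  "reduced \<longleftrightarrow> (\<exists>v. X 0 = {v})"

text \<open>
  The choice of \<open>z\<close> is unique when \<open>X\<close> is spiny. The face \<open>d\<^sub>1\<close> is \<^term>\<open>edge 2 0 2\<close>.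
\<close>

definition edge_mult :: "'a \<Rightarrow> 'a \<Rightarrow> 'a option" where
  "edge_mult x y =
    (if \<exists>z\<in>X 2. segal 2 z = [x, y]
     then Some (edge 2 0 2 (THE z. z \<in> X 2 \<and> segal 2 z = [x, y]))
     else None)"

definition edge_one :: 'a where
  "edge_one = act 1 0 (\<lambda>k\<in>{..1}. 0) (the_elem (X 0))"

end

locale chermak_partial_group = symmetric_set +
  assumes reduced: "reduced"
    and spiny: "spiny"

end

theory Submission
  imports Defs
begin

text \<open>
  A product \<open>ab = c\<close> is a 2-simplex \<open>z\<close> whose edges from \<open>0\<close> to \<open>1\<close>, from \<open>1\<close> to \<open>2\<close> and from
  \<open>0\<close> to \<open>2\<close> are \<open>a\<close>, \<open>b\<close> and \<open>c\<close>; by spininess \<open>z\<close> is determined by \<open>a\<close> and \<open>b\<close>. Let \<open>a\<^sup>\<dagger>\<close> be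
  the reversal of the edge \<open>a\<close>. Permuting the vertices of \<open>z\<close> turns one product into another:
  exchanging \<open>0\<close> and \<open>1\<close> gives a 2-simplex witnessing \<open>a\<^sup>\<dagger> c = b\<close>, and exchanging \<open>1\<close> and \<open>2\<close>
  gives one witnessing \<open>c b\<^sup>\<dagger> = a\<close>. These are the two conditions on an inverse. The unit laws
  are witnessed by the two degeneracies of a 1-simplex, since \<open>X\<^sub>0\<close> being a point forces every
  constant edge to be the unit.
\<close>

context symmetric_set
begin

lemma edge_hom:
  assumes "i \<le> n" "j \<le> n"
  shows "(\<lambda>k\<in>{..1}. if k = 0 then i else j) \<in> Upsilon_hom 1 n"
  using assms by (auto simp: Upsilon_hom_def)

lemma edge_closed: "x \<in> X n \<Longrightarrow> i \<le> n \<Longrightarrow> j \<le> n \<Longrightarrow> edge n i j x \<in> X 1"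
  unfolding edge_def by (blast intro: act_closed edge_hom)

lemma edge_act:
  assumes "f \<in> Upsilon_hom m n" "x \<in> X n" "i \<le> m" "j \<le> m"
  shows "edge m i j (act m n f x) = edge n (f i) (f j) x"
proof -
  have "compose {..1} f (\<lambda>k\<in>{..1::nat}. if k = 0 then i else j)
      = (\<lambda>k\<in>{..1}. if k = 0 then f i else f j)"
    by (auto simp: compose_def)
  then show ?thesis
    unfolding edge_def using act_compose[OF edge_hom[OF assms(3,4)] assms(1,2)] by (simp del: One_nat_def)
qed

lemma edge_edge:
  assumes "x \<in> X n" "i \<le> n" "j \<le> n" "k \<le> 1" "l \<le> 1"
  shows "edge 1 k l (edge n i j x) = edge n (if k = 0 then i else j) (if l = 0 then i else j) x"
  using edge_act[OF edge_hom[OF assms(2,3)] assms(1,4,5)] assms(4,5)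
  unfolding edge_def[of n i j] by simp

lemma edge_0_1:
  assumes "x \<in> X 1"
  shows "edge 1 0 1 x = x"
proof -
  have "(\<lambda>k\<in>{..1}. if k = 0 then 0 else 1) = (\<lambda>k\<in>{..1::nat}. k)"
    by (auto simp: restrict_def)
  then show ?thesis
    unfolding edge_def using act_id[OF assms] by simp
qed

lemma segal_2: "segal 2 x = [edge 2 0 1 x, edge 2 1 2 x]"
  by (simp add: segal_def upt_rec numeral_2_eq_2)

end

context chermak_partial_group
begin

text \<open>An edge from a vertex to itself factors through \<^term>\<open>X 0\<close>.\<close>

lemma edge_same:
  assumes "x \<in> X n" "i \<le> n"
  shows "edge n i i x = edge_one"
proof -
  obtain v where v: "X 0 = {v}"
    using reduced unfolding reduced_def by blast
  have vertex: "(\<lambda>k\<in>{..0}. i) \<in> Upsilon_hom 0 n"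
    using assms by (auto simp: Upsilon_hom_def)
  have degen: "(\<lambda>k\<in>{..1}. 0) \<in> Upsilon_hom 1 0"
    by (auto simp: Upsilon_hom_def)
  have "compose {..1} (\<lambda>k\<in>{..0::nat}. i) (\<lambda>k\<in>{..1}. 0) = (\<lambda>k\<in>{..1::nat}. if k = 0 then i else i)"
    by (auto simp: compose_def)
  then have "edge n i i x = act 1 0 (\<lambda>k\<in>{..1}. 0) (act 0 n (\<lambda>k\<in>{..0}. i) x)"
    unfolding edge_def using act_compose[OF degen vertex assms(1)] by (simp del: One_nat_def)
  moreover have "act 0 n (\<lambda>k\<in>{..0}. i) x = v"
    using act_closed[OF vertex assms(1)] v by simp
  ultimately show ?thesis
    unfolding edge_one_def using v by simp
qed

lemma edge_mult_eq_Some_iff: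
  "edge_mult x y = Some c \<longleftrightarrow> (\<exists>z\<in>X 2. edge 2 0 1 z = x \<and> edge 2 1 2 z = y \<and> edge 2 0 2 z = c)"
proof -
  have "inj_on (segal 2) (X 2)"
    using spiny unfolding spiny_def by simp
  then have "(THE w. w \<in> X 2 \<and> segal 2 w = [x, y]) = z"
    if "z \<in> X 2" "segal 2 z = [x, y]" for z
    using that by (intro the_equality) (auto simp: inj_on_def)
  then show ?thesis
    unfolding edge_mult_def by (auto simp: segal_2)
qed

text \<open>
  The triangle of a simplex \<open>x\<close> on vertices \<open>i\<close>, \<open>j\<close>, \<open>k\<close>, repetitions allowed, witnesses a
  product of edges.
\<close>

lemma edge_mult_edge:
  assumes "x \<in> X n" "i \<le> n" "j \<le> n" "k \<le> n"
  shows "edge_mult (edge n i j x) (edge n j k x) = Some (edge n i k x)"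
proof -
  define f where "f = (\<lambda>l\<in>{..2::nat}. if l = 0 then i else if l = 1 then j else k)"
  have f: "f \<in> Upsilon_hom 2 n"
    using assms by (auto simp: Upsilon_hom_def f_def)
  have vals: "f 0 = i" "f 1 = j" "f 2 = k"
    by (auto simp: f_def)
  show ?thesis
    unfolding edge_mult_eq_Some_iff
  proof (intro bexI conjI)
    show "act 2 n f x \<in> X 2"
      by (rule act_closed[OF f assms(1)])
  qed (simp_all add: edge_act[OF f assms(1)] vals del: One_nat_def)
qed

lemma edge_mult_edge_one_right: "a \<in> X 1 \<Longrightarrow> edge_mult a edge_one = Some a"
  using edge_mult_edge[of a 1 0 1 1] by (simp add: edge_0_1 edge_same del: One_nat_def)

lemma edge_mult_edge_one_left: "a \<in> X 1 \<Longrightarrow> edge_mult edge_one a = Some a"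
  using edge_mult_edge[of a 1 0 0 1] by (simp add: edge_0_1 edge_same del: One_nat_def)

lemma edge_mult_reverse_left:
  assumes "edge_mult a b = Some c"
  shows "edge_mult (edge 1 1 0 a) c = Some b"
proof -
  obtain z where z: "z \<in> X 2" "edge 2 0 1 z = a" "edge 2 1 2 z = b" "edge 2 0 2 z = c"
    using assms unfolding edge_mult_eq_Some_iff by blast
  have "edge 1 1 0 a = edge 2 1 0 z"
    using edge_edge[of z 2 0 1 1 0] z by simp
  then show ?thesis
    using edge_mult_edge[of z 2 1 0 2] z by simp
qed

lemma edge_mult_reverse_right:
  assumes "edge_mult a b = Some c"
  shows "edge_mult c (edge 1 1 0 b) = Some a"
proof -
  obtain z where z: "z \<in> X 2" "edge 2 0 1 z = a" "edge 2 1 2 z = b" "edge 2 0 2 z = c"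
    using assms unfolding edge_mult_eq_Some_iff by blast
  have "edge 1 1 0 b = edge 2 2 1 z"
    using edge_edge[of z 2 1 2 1 0] z by simp
  then show ?thesis
    using edge_mult_edge[of z 2 0 2 1] z by simp
qed

lemma edge_one_closed: "edge_one \<in> X 1"
proof -
  obtain v where "v \<in> X 0"
    using reduced unfolding reduced_def by blast
  then show ?thesis
    using edge_closed[of v 0 0 0] edge_same[of v 0 0] by simp
qed

lemma binary_partial_group_edges: "binary_partial_group (X 1) edge_mult edge_one"
proof
  fix a b c
  assume "edge_mult a b = Some c"
  then show "c \<in> X 1"
    unfolding edge_mult_eq_Some_iff by (auto intro: edge_closed simp del: One_nat_def)
next
  fix a
  assume "a \<in> X 1"
  then have "edge 1 1 0 a \<in> X 1"
    by (simp add: edge_closed del: One_nat_def)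
  then show "\<exists>a'\<in>X 1. \<forall>b\<in>X 1. (\<forall>c. edge_mult a b = Some c \<longrightarrow> edge_mult a' c = Some b) \<and>
      (\<forall>c. edge_mult b a = Some c \<longrightarrow> edge_mult c a' = Some b)"
    using edge_mult_reverse_left edge_mult_reverse_right by blast
qed (rule edge_one_closed edge_mult_edge_one_right edge_mult_edge_one_left; assumption?)+

end

theorem proposition9:
  fixes X :: "nat \<Rightarrow> 'a set" and act :: "nat \<Rightarrow> nat \<Rightarrow> (nat \<Rightarrow> nat) \<Rightarrow> 'a \<Rightarrow> 'a"
  assumes "chermak_partial_group X act"
  shows "binary_partial_group (X 1) (symmetric_set.edge_mult X act) (symmetric_set.edge_one X act)"
  using assms by (rule chermak_partial_group.binary_partial_group_edges)

end
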